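(* Let $\Phi$ be a finite family of graph signals. Then the range function $J_{\mathcal{S}(\Phi)}$ of the graph shift-invariant space $\mathcal{S}(\Phi)$ generated by $\Phi$ satisfies $$J_{\mathcal{S}(\Phi)}(\boldsymbol{\gamma}(m))=\mathrm{span}\{\widehat{\phi}(m)\ :\ \phi\in\Phi\},\quad 1\le m\le M.$$
   Context: Let $\mathcal{G}=(V,E,\mathbf{W})$ be a finite, simple, undirected graph with $N\ge 2$ vertices. A graph signal is a vector in $\mathbb{R}^V$. A graph shift is a matrix $\mathbf{S}=[s(i,j)]_{i,j\in V}$ with $s(i,j)=0$ unless $i=j$ or $(i,j)\in E$. Standing assumption: $\mathbf{S}_1,\ldots,\mathbf{S}_d$ are graph shifts that are real-valued, symmetric and pairwise commuting. Choose an orthogonal matrix $\mathbf{U}=[\mathbf{u}_1,\ldots,\mathbf{u}_N]$ with $\mathbf{S}_l=\sum_{n=1}^N\lambda_l(n)\mathbf{u}_n\mathbf{u}_n^T$ for $1\le l\le d$, and set $\boldsymbol{\lambda}(n)=[\lambda_1(n),\ldots,\lambda_d(n)]^T\in\mathbb{R}^d$. Let $\boldsymbol{\gamma}(m)=[\gamma_1(m),\ldots,\gamma_d(m)]^T$, $1\le m\le M$, be the distinct elements of $\{\boldsymbol{\lambda}(n): 1\le n\le N\}$. Put $\mathbf{P}_m=\sum_{\boldsymbol{\lambda}(n)=\boldsymbol{\gamma}(m)}\mathbf{u}_n\mathbf{u}_n^T$ (independent of the choice of $\mathbf{U}$), $W_m=\mathbf{P}_m\mathbb{R}^V=\bigcap_{l=1}^d\ker(\mathbf{S}_l-\gamma_l(m)\mathbf{I})$,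 and $\widehat{\mathbf{x}}(m)=\mathbf{P}_m\mathbf{x}$ for $\mathbf{x}\in\mathbb{R}^V$. A graph shift-invariant space is a linear space $U$ of graph signals such that $\mathbf{S}_l\mathbf{x}\in U$ for all $1\le l\le d$ and $\mathbf{x}\in U$; its range function is $J_U(\boldsymbol{\gamma}(m))=U\cap W_m$, $1\le m\le M$. For a family $\Phi$ of graph signals, $\mathcal{S}(\Phi)=\mathrm{span}\{\mathbf{S}_1^{\alpha_1}\cdots\mathbf{S}_d^{\alpha_d}\phi : \alpha_1,\ldots,\alpha_d\in\mathbb{Z}_+,\ \phi\in\Phi\}$, where $\mathbb{Z}_+$ denotes the nonnegative integers. *)

theory Defs
  imports "HOL-Analysis.Analysis"
begin

text \<open>
  The vertex set is the universe of a finite type, so that graph signals are elements of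
  \<open>real ^ 'v\<close> and shifts are matrices \<open>real ^ 'v ^ 'v\<close>; the number of vertices is \<open>CARD('v)\<close>.
  The shifts are indexed by a finite linearly ordered type \<open>'d\<close> (so \<open>d = CARD('d)\<close>); the order
  only serves to write down the product of matrix powers from left to right.
\<close>

definition simple_graph :: "('v \<Rightarrow> 'v \<Rightarrow> bool) \<Rightarrow> bool" where
  "simple_graph E \<longleftrightarrow> symp E \<and> irreflp E"

definition graph_shift :: "('v \<Rightarrow> 'v \<Rightarrow> bool) \<Rightarrow> real ^ 'v::finite ^ 'v \<Rightarrow> bool" where
  "graph_shift E A \<longleftrightarrow> (\<forall>i j. \<not> (i = j \<or> E i j) \<longrightarrow> A $ i $ j = 0)"

text \<open>The rank-one matrix \<open>x x\<^sup>T\<close>.\<close>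

definition outer :: "real ^ 'v::finite \<Rightarrow> real ^ 'v ^ 'v" where
  "outer x = (columnvector x :: real ^ 1 ^ 'v) ** rowvector x"

text \<open>
  The orthonormal basis is given by the columns of \<open>U\<close>, so that it is indexed by \<open>'v\<close>
  rather than by \<open>{1..N}\<close>; \<open>lam n\<close> is the joint eigenvalue of the \<open>n\<close>-th column.
\<close>

definition joint_diagonalization ::
  "('d \<Rightarrow> real ^ 'v ^ 'v) \<Rightarrow> real ^ 'v::finite ^ 'v \<Rightarrow> ('v \<Rightarrow> real ^ 'd::finite) \<Rightarrow> bool" where
  "joint_diagonalization S U lam \<longleftrightarrow>
     orthogonal_matrix U \<and> (\<forall>l. S l = (\<Sum>n\<in>UNIV. (lam n $ l) *\<^sub>R outer (column n U)))"

definition spectral_projection ::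
  "real ^ 'v::finite ^ 'v \<Rightarrow> ('v \<Rightarrow> real ^ 'd::finite) \<Rightarrow> real ^ 'd \<Rightarrow> real ^ 'v ^ 'v" where
  "spectral_projection U lam g = (\<Sum>n | lam n = g. outer (column n U))"

definition joint_eigenspace ::
  "real ^ 'v::finite ^ 'v \<Rightarrow> ('v \<Rightarrow> real ^ 'd::finite) \<Rightarrow> real ^ 'd \<Rightarrow> (real ^ 'v) set" where
  "joint_eigenspace U lam g = range (\<lambda>x. spectral_projection U lam g *v x)"

definition graph_fourier ::
  "real ^ 'v::finite ^ 'v \<Rightarrow> ('v \<Rightarrow> real ^ 'd::finite) \<Rightarrow> real ^ 'v \<Rightarrow> real ^ 'd \<Rightarrow> real ^ 'v" where
  "graph_fourier U lam x g = spectral_projection U lam g *v x"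

definition shift_invariant_space :: "('d \<Rightarrow> real ^ 'v ^ 'v) \<Rightarrow> (real ^ 'v::finite) set \<Rightarrow> bool" where
  "shift_invariant_space S H \<longleftrightarrow> subspace H \<and> (\<forall>l. \<forall>x\<in>H. S l *v x \<in> H)"

definition range_function ::
  "real ^ 'v::finite ^ 'v \<Rightarrow> ('v \<Rightarrow> real ^ 'd::finite) \<Rightarrow> (real ^ 'v) set \<Rightarrow> real ^ 'd \<Rightarrow> (real ^ 'v) set" where
  "range_function U lam H g = H \<inter> joint_eigenspace U lam g"

text \<open>The operation \<open>^\<close> on the type \<open>real ^ 'v ^ 'v\<close> is entrywise, hence a separate matrix power.\<close>

definition mat_power :: "real ^ 'v::finite ^ 'v \<Rightarrow> nat \<Rightarrow> real ^ 'v ^ 'v" where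
  "mat_power A k = (((**) A) ^^ k) (mat 1)"

definition shift_monomial ::
  "('d \<Rightarrow> real ^ 'v::finite ^ 'v) \<Rightarrow> ('d::{finite,linorder} \<Rightarrow> nat) \<Rightarrow> real ^ 'v ^ 'v" where
  "shift_monomial S \<alpha> =
     foldr (\<lambda>l B. mat_power (S l) (\<alpha> l) ** B) (sorted_list_of_set UNIV) (mat 1)"

definition generated_space ::
  "('d::{finite,linorder} \<Rightarrow> real ^ 'v::finite ^ 'v) \<Rightarrow> (real ^ 'v) set \<Rightarrow> (real ^ 'v) set" where
  "generated_space S \<Phi> = span {shift_monomial S \<alpha> *v \<phi> | \<alpha> \<phi>. \<phi> \<in> \<Phi>}"

text \<open>
  Two facts the definitions rely on: the space generated by a family is shift-invariant, and
  the ranges of the spectral projections are the joint eigenspaces (in particular, they do not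
  depend on the choice of \<open>U\<close>).
\<close>

lemma mat_power_Suc: "mat_power A (Suc k) = A ** mat_power A k"
  by (simp add: mat_power_def)

lemma mat_power_commute:
  assumes "B ** A = A ** B"
  shows "B ** mat_power A k = mat_power A k ** B"
proof (induction k)
  case 0
  show ?case by (simp add: mat_power_def)
next
  case (Suc k)
  have "B ** (A ** mat_power A k) = A ** (B ** mat_power A k)"
    by (simp add: assms matrix_mul_assoc)
  then show ?case by (simp add: mat_power_Suc Suc.IH matrix_mul_assoc)
qed

lemma foldr_monomial_shift:
  assumes comm: "\<And>k l. S k ** S l = S l ** S k" and "distinct ls" "k \<in> set ls"
  shows "S k ** foldr (\<lambda>l B. mat_power (S l) (\<alpha> l) ** B) ls (mat 1) =
         foldr (\<lambda>l B. mat_power (S l) ((\<alpha>(k := Suc (\<alpha> k))) l) ** B) ls (mat 1)"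
  using assms(2,3)
proof (induction ls)
  case Nil
  then show ?case by simp
next
  case (Cons a ls)
  let ?R = "\<lambda>\<beta>. foldr (\<lambda>l B. mat_power (S l) (\<beta> l) ** B) ls (mat 1)"
  show ?case
  proof (cases "a = k")
    case True
    have "?R (\<alpha>(k := Suc (\<alpha> k))) = ?R \<alpha>"
      using Cons.prems True by (intro foldr_cong) auto
    with True show ?thesis by (simp add: mat_power_Suc matrix_mul_assoc)
  next
    case False
    then have "S k ** ?R \<alpha> = ?R (\<alpha>(k := Suc (\<alpha> k)))"
      using Cons by simp
    moreover have "S k ** (mat_power (S a) (\<alpha> a) ** ?R \<alpha>) =
        mat_power (S a) (\<alpha> a) ** (S k ** ?R \<alpha>)"
      unfolding matrix_mul_assoc mat_power_commute[OF comm[of k a]] ..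
    ultimately show ?thesis using False by simp
  qed
qed

lemma shift_invariant_generated_space:
  fixes S :: "'d::{finite,linorder} \<Rightarrow> real ^ 'v::finite ^ 'v"
  assumes comm: "\<And>k l. S k ** S l = S l ** S k"
  shows "shift_invariant_space S (generated_space S \<Phi>)"
  unfolding shift_invariant_space_def
proof (intro conjI allI ballI)
  show "subspace (generated_space S \<Phi>)"
    by (simp add: generated_space_def)
next
  fix k x
  assume "x \<in> generated_space S \<Phi>"
  let ?G = "{shift_monomial S \<alpha> *v \<phi> | \<alpha> \<phi>. \<phi> \<in> \<Phi>}"
  have "(*v) (S k) ` ?G \<subseteq> ?G"
  proof clarify
    fix \<alpha> \<phi> assume "\<phi> \<in> \<Phi>"
    have "S k ** shift_monomial S \<alpha> = shift_monomial S (\<alpha>(k := Suc (\<alpha> k)))"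
      unfolding shift_monomial_def by (rule foldr_monomial_shift) (auto simp: comm)
    then have "S k *v (shift_monomial S \<alpha> *v \<phi>) = shift_monomial S (\<alpha>(k := Suc (\<alpha> k))) *v \<phi>"
      by (simp add: matrix_vector_mul_assoc)
    with \<open>\<phi> \<in> \<Phi>\<close> show "\<exists>\<beta> \<psi>. S k *v (shift_monomial S \<alpha> *v \<phi>) = shift_monomial S \<beta> *v \<psi> \<and> \<psi> \<in> \<Phi>"
      by blast
  qed
  moreover have "S k *v x \<in> span ((*v) (S k) ` ?G)"
    using \<open>x \<in> generated_space S \<Phi>\<close>
    by (simp add: generated_space_def linear_span_image[OF matrix_vector_mul_linear])
  ultimately show "S k *v x \<in> generated_space S \<Phi>"
    unfolding generated_space_def using span_mono by blast
qed

lemma outer_mult: "outer u *v x = (u \<bullet> x) *\<^sub>R u"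
  by (vector outer_def matrix_vector_mult_def matrix_matrix_mult_def columnvector_def
      rowvector_def inner_vec_def sum_distrib_left mult_ac)

lemma sum_matrix_vector_mult:
  "(\<Sum>i\<in>I. A i) *v x = (\<Sum>i\<in>I. A i *v (x :: real ^ 'v::finite))"
  by (induction I rule: infinite_finite_induct) (auto simp: matrix_vector_mult_add_rdistrib)

lemma spectral_projection_mult:
  "spectral_projection U lam g *v x = (\<Sum>n | lam n = g. (column n U \<bullet> x) *\<^sub>R column n U)"
  by (simp add: spectral_projection_def sum_matrix_vector_mult outer_mult)

lemma joint_eigenspace_eq:
  assumes "joint_diagonalization S U lam"
  shows "joint_eigenspace U lam g = (\<Inter>l. {x. S l *v x = (g $ l) *\<^sub>R x})"
proof -
  let ?u = "\<lambda>n. column n U"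
  have orth: "orthogonal_matrix U"
    and S: "S l = (\<Sum>n\<in>UNIV. (lam n $ l) *\<^sub>R outer (?u n))" for l
    using assms by (auto simp: joint_diagonalization_def)
  have on: "?u m \<bullet> ?u n = (if m = n then 1 else 0)" for m n
  proof -
    have "(transpose U ** U) $ m $ n = mat 1 $ m $ n"
      using orth by (simp add: orthogonal_matrix)
    then show ?thesis
      by (simp add: matrix_matrix_mult_def transpose_def mat_def column_def inner_vec_def)
  qed
  have Smul: "S l *v x = (\<Sum>n\<in>UNIV. (lam n $ l) *\<^sub>R (?u n \<bullet> x) *\<^sub>R ?u n)" for l x
    by (simp add: S sum_matrix_vector_mult outer_mult flip: scaleR_matrix_vector_assoc)
  have Su: "S l *v ?u m = (lam m $ l) *\<^sub>R ?u m" for l m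
  proof -
    have "S l *v ?u m = (\<Sum>n\<in>UNIV. if n = m then (lam m $ l) *\<^sub>R ?u m else 0)"
      unfolding Smul by (rule sum.cong) (auto simp: on)
    then show ?thesis by simp
  qed
  have expand: "x = (\<Sum>n\<in>UNIV. (?u n \<bullet> x) *\<^sub>R ?u n)" for x
  proof -
    have "x = (U ** transpose U) *v x"
      using orth by (simp add: orthogonal_matrix_def)
    also have "\<dots> = U *v (transpose U *v x)"
      by (simp only: matrix_vector_mul_assoc)
    also have "\<dots> = (\<Sum>n\<in>UNIV. (?u n \<bullet> x) *\<^sub>R ?u n)"
      unfolding matrix_mult_sum
      by (rule sum.cong) (auto simp: matrix_vector_mult_def transpose_def column_def
          inner_vec_def scalar_mult_eq_scaleR vector_matrix_mult_def mult.commute)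
    finally show ?thesis .
  qed
  show ?thesis
  proof (intro set_eqI iffI)
    fix x assume "x \<in> joint_eigenspace U lam g"
    then obtain y where x: "x = (\<Sum>n | lam n = g. (?u n \<bullet> y) *\<^sub>R ?u n)"
      by (auto simp: joint_eigenspace_def spectral_projection_mult)
    have "S l *v x = (g $ l) *\<^sub>R x" for l
      unfolding x
      by (simp add: scaleR_sum_right linear_sum[OF matrix_vector_mul_linear]
          matrix_vector_mult_scaleR Su ac_simps)
    then show "x \<in> (\<Inter>l. {x. S l *v x = (g $ l) *\<^sub>R x})" by simp
  next
    fix x assume "x \<in> (\<Inter>l. {x. S l *v x = (g $ l) *\<^sub>R x})"
    then have eig: "S l *v x = (g $ l) *\<^sub>R x" for l by simp
    have zero: "?u m \<bullet> x = 0" if neq: "lam m \<noteq> g" for m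
    proof -
      obtain l where l: "lam m $ l \<noteq> g $ l"
        using neq unfolding vec_eq_iff by blast
      have "?u m \<bullet> (S l *v x) =
          (\<Sum>n\<in>UNIV. if n = m then (lam m $ l) * (?u m \<bullet> x) else 0)"
        unfolding Smul inner_sum_right by (rule sum.cong) (auto simp: on)
      then have "(g $ l) * (?u m \<bullet> x) = (lam m $ l) * (?u m \<bullet> x)"
        by (simp add: eig)
      with l show ?thesis by simp
    qed
    have "x = (\<Sum>n | lam n = g. (?u n \<bullet> x) *\<^sub>R ?u n)"
      by (rule trans[OF expand], rule sum.mono_neutral_right) (auto simp: zero)
    then have "x = spectral_projection U lam g *v x"
      unfolding spectral_projection_mult .
    then show "x \<in> joint_eigenspace U lam g"
      unfolding joint_eigenspace_def by (rule range_eqI)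
  qed
qed

end

theory Submission
  imports Defs
begin

text \<open>
  On a shift-invariant space \<open>H\<close> the spectral projection for a joint eigenvalue \<open>g\<close> acts as a
  polynomial in the shifts: the factor \<open>(S l - \<mu> l) / (g l - \<mu> l)\<close> with \<open>\<mu> l \<noteq> g l\<close> removes the
  component of another joint eigenvalue \<open>\<mu>\<close> and does not change the \<open>g\<close>-component. Hence \<open>H\<close> is
  mapped into itself and \<open>H \<inter> W\<close> is the projection of \<open>H\<close>. As a monomial in the shifts acts on
  \<open>W\<close> as a scalar, the monomials \<open>S\<^sup>\<alpha> \<phi>\<close> project to multiples of the projection of \<open>\<phi>\<close>.
\<close>

lemma inner_columns_orthogonal_matrix:
  fixes U :: "real ^ 'v::finite ^ 'v"
  assumes "orthogonal_matrix U"
  shows "column m U \<bullet> column n U = (if m = n then 1 else 0)"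
proof -
  have "(transpose U ** U) $ m $ n = mat 1 $ m $ n"
    using assms by (simp add: orthogonal_matrix)
  then show ?thesis
    by (simp add: matrix_matrix_mult_def transpose_def mat_def column_def inner_vec_def)
qed

lemma orthogonal_matrix_expansion:
  fixes U :: "real ^ 'v::finite ^ 'v"
  assumes "orthogonal_matrix U"
  shows "x = (\<Sum>n\<in>UNIV. (column n U \<bullet> x) *\<^sub>R column n U)"
proof -
  have "x = (U ** transpose U) *v x"
    using assms by (simp add: orthogonal_matrix_def)
  also have "\<dots> = U *v (transpose U *v x)"
    by (simp only: matrix_vector_mul_assoc)
  also have "\<dots> = (\<Sum>n\<in>UNIV. (column n U \<bullet> x) *\<^sub>R column n U)"
    unfolding matrix_mult_sum
    by (rule sum.cong) (auto simp: matrix_vector_mult_def transpose_def column_def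
        inner_vec_def scalar_mult_eq_scaleR vector_matrix_mult_def mult.commute)
  finally show ?thesis .
qed

lemma inner_column_sum_columns:
  fixes U :: "real ^ 'v::finite ^ 'v"
  assumes "orthogonal_matrix U"
  shows "column m U \<bullet> (\<Sum>n\<in>A. c n *\<^sub>R column n U) = (if m \<in> A then c m else 0)"
proof -
  have "column m U \<bullet> (\<Sum>n\<in>A. c n *\<^sub>R column n U) = (\<Sum>n\<in>A. if m = n then c m else 0)"
    unfolding inner_sum_right
    by (rule sum.cong) (auto simp: inner_columns_orthogonal_matrix[OF assms])
  then show ?thesis by simp
qed

text \<open>In the orthonormal basis of the columns of \<open>U\<close> all shifts are diagonal at
  once; how shifts and projections interact is derived from this coordinate form.\<close>

lemma inner_column_shift:
  assumes "joint_diagonalization S U lam"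
  shows "column n U \<bullet> (S l *v x) = (lam n $ l) * (column n U \<bullet> x)"
proof -
  have orth: "orthogonal_matrix U"
    and S: "S l = (\<Sum>n\<in>UNIV. (lam n $ l) *\<^sub>R outer (column n U))"
    using assms by (auto simp: joint_diagonalization_def)
  have "S l *v x = (\<Sum>n\<in>UNIV. ((lam n $ l) * (column n U \<bullet> x)) *\<^sub>R column n U)"
    by (simp add: S sum_matrix_vector_mult outer_mult flip: scaleR_matrix_vector_assoc)
  then show ?thesis
    by (simp add: inner_column_sum_columns[OF orth])
qed

text \<open>Only the coordinates with \<open>lam n = g\<close> survive the projection, and on each
  of them the shift multiplies by \<open>g $ l\<close>.\<close>

lemma spectral_projection_shift:
  assumes "joint_diagonalization S U lam"
  shows "spectral_projection U lam g *v (S l *v x) = (g $ l) *\<^sub>R (spectral_projection U lam g *v x)"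
  by (simp add: spectral_projection_mult inner_column_shift[OF assms] scaleR_sum_right)

lemma spectral_projection_eq_self:
  assumes "orthogonal_matrix U" and "\<And>n. lam n \<noteq> g \<Longrightarrow> column n U \<bullet> x = 0"
  shows "spectral_projection U lam g *v x = x"
proof -
  have "x = (\<Sum>n | lam n = g. (column n U \<bullet> x) *\<^sub>R column n U)"
    by (rule trans[OF orthogonal_matrix_expansion[OF assms(1)]], rule sum.mono_neutral_right)
      (auto simp: assms(2))
  then show ?thesis
    by (simp add: spectral_projection_mult)
qed

lemma spectral_projection_joint_eigenspace:
  assumes "orthogonal_matrix U" and "x \<in> joint_eigenspace U lam g"
  shows "spectral_projection U lam g *v x = x"
proof (rule spectral_projection_eq_self[OF assms(1)])
  fix n assume "lam n \<noteq> g"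
  moreover obtain y where "x = (\<Sum>n | lam n = g. (column n U \<bullet> y) *\<^sub>R column n U)"
    using assms(2) by (auto simp: joint_eigenspace_def spectral_projection_mult)
  ultimately show "column n U \<bullet> x = 0"
    by (simp add: inner_column_sum_columns[OF assms(1)])
qed

lemma spectral_projection_shift_invariant:
  assumes diag: "joint_diagonalization S U lam"
    and H: "shift_invariant_space S H" and x: "x \<in> H"
  shows "spectral_projection U lam g *v x \<in> H"
proof -
  let ?P = "\<lambda>y. spectral_projection U lam g *v y"
  have sub: "subspace H" and inv: "\<And>l y. y \<in> H \<Longrightarrow> S l *v y \<in> H"
    using H by (auto simp: shift_invariant_space_def)
  \<comment> \<open>\<open>F\<close> holds the columns outside the eigenspace of \<open>g\<close>
    that have been removed so far. They are removed one by one, so a repeated joint eigenvalue may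
    get several factors, which does no harm.\<close>
  have "\<exists>y\<in>H. ?P y = ?P x \<and> (\<forall>n\<in>F. column n U \<bullet> y = 0)"
    if "finite F" "F \<subseteq> {n. lam n \<noteq> g}" for F
    using that
  proof (induction F rule: finite_induct)
    case empty
    show ?case using x by blast
  next
    case (insert k F)
    then obtain y where y: "y \<in> H" "?P y = ?P x" "\<forall>n\<in>F. column n U \<bullet> y = 0"
      by auto
    \<comment> \<open>Two different joint eigenvalues differ in some entry, so a single shift
      separates them; \<open>l\<close> depends on \<open>k\<close>.\<close>
    obtain l where l: "lam k $ l \<noteq> g $ l"
      using insert.prems by (auto simp: vec_eq_iff)
    \<comment> \<open>Coordinate \<open>n\<close> gets multiplied by
      \<open>(lam n $ l - lam k $ l) / (g $ l - lam k $ l)\<close>. This is 0 for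
      \<open>n = k\<close> and 1 if \<open>lam n = g\<close>, and the zeros on \<open>F\<close>
      remain zeros.\<close>
    define z where "z = inverse (g $ l - lam k $ l) *\<^sub>R (S l *v y - (lam k $ l) *\<^sub>R y)"
    have "z \<in> H"
      unfolding z_def by (intro subspace_scale[OF sub] subspace_diff[OF sub] inv y(1))
    moreover have "?P z = ?P y"
    proof -
      have "?P z = inverse (g $ l - lam k $ l) *\<^sub>R ((g $ l) *\<^sub>R ?P y - (lam k $ l) *\<^sub>R ?P y)"
        by (simp add: z_def matrix_vector_mult_scaleR matrix_vector_mult_diff_distrib
            spectral_projection_shift[OF diag])
      with l show ?thesis by (simp flip: scaleR_diff_left)
    qed
    moreover have "column n U \<bullet> z = 0" if "n \<in> insert k F" for n
      using that y(3) by (auto simp: z_def inner_diff_right inner_column_shift[OF diag])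
    ultimately show ?case using y(2) by auto
  qed
  \<comment> \<open>Once every column with \<open>lam n \<noteq> g\<close> is removed, the
    projection fixes \<open>y\<close>, so the projection of \<open>x\<close> is \<open>y\<close>
    itself and lies in \<open>H\<close>.\<close>
  from this[of "{n. lam n \<noteq> g}"] obtain y
    where y: "y \<in> H" "?P y = ?P x" "\<And>n. lam n \<noteq> g \<Longrightarrow> column n U \<bullet> y = 0"
    by auto
  have "?P y = y"
    using diag y(3) by (intro spectral_projection_eq_self) (auto simp: joint_diagonalization_def)
  with y show ?thesis by simp
qed

text \<open>A vector of \<open>H\<close> in the joint eigenspace is its own projection; conversely,
  projections of vectors of \<open>H\<close> stay in \<open>H\<close> by shift-invariance.\<close>

lemma range_function_shift_invariant:
  assumes diag: "joint_diagonalization S U lam" and H: "shift_invariant_space S H"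
  shows "range_function U lam H g = (*v) (spectral_projection U lam g) ` H"
proof -
  have "orthogonal_matrix U"
    using diag by (simp add: joint_diagonalization_def)
  then have "x \<in> (*v) (spectral_projection U lam g) ` H"
    if "x \<in> H" "x \<in> joint_eigenspace U lam g" for x
    using that spectral_projection_joint_eigenspace by (metis imageI)
  then show ?thesis
    by (auto simp: range_function_def joint_eigenspace_def
        spectral_projection_shift_invariant[OF diag H])
qed

lemma spectral_projection_mat_power:
  assumes "joint_diagonalization S U lam"
  shows "spectral_projection U lam g *v (mat_power (S l) k *v x) =
    (g $ l) ^ k *\<^sub>R (spectral_projection U lam g *v x)"
proof (induction k)
  case 0
  show ?case by (simp add: mat_power_def)
next
  case (Suc k)
  then show ?case
    by (simp add: mat_power_Suc spectral_projection_shift[OF assms] flip: matrix_vector_mul_assoc)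
qed

text \<open>The scalar is the product of the powers \<open>(g $ l) ^ \<alpha> l\<close>; for
  comparing spans its existence suffices.\<close>

lemma spectral_projection_shift_monomial:
  assumes "joint_diagonalization S U lam"
  shows "\<exists>c. spectral_projection U lam g *v (shift_monomial S \<alpha> *v x) =
    c *\<^sub>R (spectral_projection U lam g *v x)"
proof -
  \<comment> \<open>The sorted list of all indices is generalised to an arbitrary list so that the
    induction goes through.\<close>
  have "\<exists>c. spectral_projection U lam g *v
      (foldr (\<lambda>l B. mat_power (S l) (\<alpha> l) ** B) ls (mat 1) *v x) =
      c *\<^sub>R (spectral_projection U lam g *v x)" for ls
  proof (induction ls)
    case Nil
    show ?case by (auto intro: exI[of _ 1])
  next
    case (Cons l ls)
    then obtain c where "spectral_projection U lam g *v
        (foldr (\<lambda>l B. mat_power (S l) (\<alpha> l) ** B) ls (mat 1) *v x) =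
        c *\<^sub>R (spectral_projection U lam g *v x)" ..
    then show ?case
      by (intro exI[of _ "(g $ l) ^ \<alpha> l * c"])
        (simp add: spectral_projection_mat_power[OF assms] flip: matrix_vector_mul_assoc)
  qed
  then show ?thesis by (simp add: shift_monomial_def)
qed

text \<open>The monomial with all exponents zero is the identity matrix.\<close>

lemma generated_space_superset: "\<Phi> \<subseteq> generated_space S \<Phi>"
proof
  fix \<phi> assume "\<phi> \<in> \<Phi>"
  have "foldr (\<lambda>l B. mat_power (S l) 0 ** B) ls (mat 1) = mat 1" for ls
    by (induction ls) (simp_all add: mat_power_def)
  then have "shift_monomial S (\<lambda>_. 0) *v \<phi> = \<phi>"
    by (simp add: shift_monomial_def)
  with \<open>\<phi> \<in> \<Phi>\<close> have "\<exists>\<alpha> \<psi>. \<phi> = shift_monomial S \<alpha> *v \<psi> \<and> \<psi> \<in> \<Phi>"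
    by metis
  then show "\<phi> \<in> generated_space S \<Phi>"
    unfolding generated_space_def by (intro span_base) blast
qed

theorem theorem4p1:
  fixes E :: "'v::finite \<Rightarrow> 'v \<Rightarrow> bool"
    and S :: "'d::{finite,linorder} \<Rightarrow> real ^ 'v ^ 'v"
    and U :: "real ^ 'v ^ 'v"
    and lam :: "'v \<Rightarrow> real ^ ('d::{finite,linorder})"
    and \<gamma> :: "nat \<Rightarrow> real ^ ('d::{finite,linorder})"
    and M m :: nat
    and \<Phi> :: "(real ^ 'v) set"
  assumes "CARD('v) \<ge> 2"
    and "simple_graph E"
    and "\<And>l. graph_shift E (S l)"
    and "\<And>l. transpose (S l) = S l"
    and "\<And>k l. S k ** S l = S l ** S k"
    and "joint_diagonalization S U lam"
    and "bij_betw \<gamma> {1..M} (range lam)"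
    and "finite \<Phi>"
    and "m \<in> {1..M}"
  shows "range_function U lam (generated_space S \<Phi>) (\<gamma> m) =
         span {graph_fourier U lam \<phi> (\<gamma> m) | \<phi>. \<phi> \<in> \<Phi>}"
proof -
  let ?P = "spectral_projection U lam (\<gamma> m)"
  let ?G = "{shift_monomial S \<alpha> *v \<phi> | \<alpha> \<phi>. \<phi> \<in> \<Phi>}"
  note diag = \<open>joint_diagonalization S U lam\<close>
  have "shift_invariant_space S (generated_space S \<Phi>)"
    using assms(5) by (rule shift_invariant_generated_space)
  then have range: "range_function U lam (generated_space S \<Phi>) (\<gamma> m) = (*v) ?P ` generated_space S \<Phi>"
    by (rule range_function_shift_invariant[OF diag])
  \<comment> \<open>By linearity the projection commutes with spans, so the upper inclusion need
    only be checked on the generators \<open>?G\<close> and the lower one reduces to the span of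
    \<open>\<Phi>\<close> lying in the generated space.\<close>
  have P_span: "(*v) ?P ` span A = span ((*v) ?P ` A)" for A
    by (simp add: linear_span_image[OF matrix_vector_mul_linear])
  have "(*v) ?P ` ?G \<subseteq> span ((*v) ?P ` \<Phi>)"
  proof clarify
    fix \<alpha> \<phi> assume "\<phi> \<in> \<Phi>"
    obtain c where "?P *v (shift_monomial S \<alpha> *v \<phi>) = c *\<^sub>R (?P *v \<phi>)"
      using spectral_projection_shift_monomial[OF diag] by blast
    with \<open>\<phi> \<in> \<Phi>\<close> show "?P *v (shift_monomial S \<alpha> *v \<phi>) \<in> span ((*v) ?P ` \<Phi>)"
      by (simp add: span_base span_scale)
  qed
  then have "(*v) ?P ` generated_space S \<Phi> \<subseteq> span ((*v) ?P ` \<Phi>)"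
    unfolding generated_space_def P_span by (simp add: span_minimal)
  moreover have "span ((*v) ?P ` \<Phi>) \<subseteq> (*v) ?P ` generated_space S \<Phi>"
    unfolding P_span[symmetric]
    by (intro image_mono span_minimal generated_space_superset) (simp add: generated_space_def)
  ultimately have "range_function U lam (generated_space S \<Phi>) (\<gamma> m) = span ((*v) ?P ` \<Phi>)"
    unfolding range by (rule subset_antisym)
  also have "(*v) ?P ` \<Phi> = {graph_fourier U lam \<phi> (\<gamma> m) | \<phi>. \<phi> \<in> \<Phi>}"
    by (auto simp: graph_fourier_def)
  finally show ?thesis .
qed

end
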